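(* Let $n\geq 1$ and let $\mathcal{X}$ be a polynomial vector field on $\mathbb{S}^n$ of degree $\mathbf{m}=(m_1,\ldots,m_{n+1})$ with $m_1\geq m_2\geq\cdots\geq m_{n+1}$. Assume that $\mathcal{X}$ has finitely many invariant parallels. Then the number of invariant parallels of $\mathcal{X}$ is at most $m_{n+1}$.
   Context: $\mathbb{S}^n=\{x\in\mathbb{R}^{n+1}:\|x\|=1\}$ with $\|\cdot\|$ the Euclidean norm. A (real) polynomial vector field $\mathcal{X}=\sum_{i=1}^{n+1}P_i(x_1,\ldots,x_{n+1})\,\partial/\partial x_i$ in $\mathbb{R}^{n+1}$, with $P_i\in\mathbb{R}[x_1,\ldots,x_{n+1}]$, has degree $\mathbf{m}=(m_1,\ldots,m_{n+1})$ if $m_i$ is the degree of $P_i$ for each $i$. It is a polynomial vector field on $\mathbb{S}^n$ if $(P_1,\ldots,P_{n+1})\cdot\nabla G=0$ at all points of $\mathbb{S}^n$, where $G=x_1^2+\cdots+x_{n+1}^2-1$. For a polynomial $f$, $\mathcal{X}f=\sum_{i=1}^{n+1}P_i\,\partial f/\partial x_i$. A hyperplane $f=0$ (with $f$ a polynomial of degree $1$) is an invariant hyperplane of $\mathcal{X}$ if $\mathcal{X}f=Kf$ for some polynomial $K$. The parallels of $\mathbb{S}^n$ are the intersections of the hyperplanes $x_{n+1}=k$, $k\in(-1,1)$ constant, with $\mathbb{S}^n$. An invariant parallel of $\mathcal{X}$ is the intersection with $\mathbb{S}^n$ of an invariant hyperplane of $\mathcal{X}$ of the form $x_{n+1}-k=0$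 with $k\in(-1,1)$. *)

theory Defs
  imports "HOL-Library.Poly_Mapping" "HOL-Analysis.Analysis"
begin

text \<open>
  Polynomials over the reals in variables indexed by a finite linearly ordered type: a monomial is
  its exponent vector, a polynomial is the finitely supported map from monomials to coefficients.
  The ring structure is the one of \<^theory>\<open>HOL-Library.Poly_Mapping\<close>.
  With \<open>CARD('n) = n + 1\<close>, the elements of \<open>'n\<close> in increasing order play the role of
  the indices \<open>1, \<dots>, n + 1\<close>.
\<close>

type_synonym 'n rpoly = "('n \<Rightarrow>\<^sub>0 nat) \<Rightarrow>\<^sub>0 real"

definition pvar :: "'n \<Rightarrow> 'n rpoly" where
  "pvar i = Poly_Mapping.single (Poly_Mapping.single i 1) 1"

definition pconst :: "real \<Rightarrow> 'n rpoly" where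
  "pconst c = Poly_Mapping.single 0 c"

definition peval :: "'n::finite rpoly \<Rightarrow> real ^ 'n \<Rightarrow> real" where
  "peval p x = (\<Sum>\<alpha>\<in>Poly_Mapping.keys p.
     Poly_Mapping.lookup p \<alpha> * (\<Prod>i\<in>UNIV. (x $ i) ^ Poly_Mapping.lookup \<alpha> i))"

text \<open>Total degree; the zero polynomial is given degree 0.\<close>

definition pdegree :: "'n::finite rpoly \<Rightarrow> nat" where
  "pdegree p =
     Max (insert 0 ((\<lambda>\<alpha>. \<Sum>i\<in>UNIV. Poly_Mapping.lookup \<alpha> i) ` Poly_Mapping.keys p))"

text \<open>
  Formal partial derivative. Subtraction of exponents truncates, but only where the exponent of the
  variable, and hence the new coefficient, is 0.
\<close>

definition pdiff :: "'n \<Rightarrow> 'n rpoly \<Rightarrow> 'n rpoly" where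
  "pdiff i p = (\<Sum>\<alpha>\<in>Poly_Mapping.keys p.
     Poly_Mapping.single (\<alpha> - Poly_Mapping.single i 1)
       (Poly_Mapping.lookup p \<alpha> * real (Poly_Mapping.lookup \<alpha> i)))"

text \<open>A polynomial vector field is the family \<open>P\<close> of its components.\<close>

type_synonym 'n pvfield = "'n \<Rightarrow> 'n rpoly"

definition vf_apply :: "'n::finite pvfield \<Rightarrow> 'n rpoly \<Rightarrow> 'n rpoly" where
  "vf_apply P f = (\<Sum>i\<in>UNIV. P i * pdiff i f)"

definition has_vf_degree :: "'n::finite pvfield \<Rightarrow> ('n \<Rightarrow> nat) \<Rightarrow> bool" where
  "has_vf_degree P m \<longleftrightarrow> (\<forall>i. m i = pdegree (P i))"

definition sphere_poly :: "'n::finite rpoly" where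
  "sphere_poly = (\<Sum>i\<in>UNIV. (pvar i)\<^sup>2) - 1"

definition vf_on_sphere :: "'n::finite pvfield \<Rightarrow> bool" where
  "vf_on_sphere P \<longleftrightarrow>
     (\<forall>x\<in>sphere (0 :: real ^ 'n) 1. (\<Sum>i\<in>UNIV. peval (P i) x * peval (pdiff i sphere_poly) x) = 0)"

definition invariant_hyperplane :: "'n::finite pvfield \<Rightarrow> 'n rpoly \<Rightarrow> bool" where
  "invariant_hyperplane P f \<longleftrightarrow> pdegree f = 1 \<and> (\<exists>K. vf_apply P f = K * f)"

definition last_index :: "'n::{finite, linorder}" where
  "last_index = Max UNIV"

definition parallel_poly :: "real \<Rightarrow> 'n::{finite, linorder} rpoly" where
  "parallel_poly k = pvar last_index - pconst k"

definition invariant_parallels :: "'n::{finite, linorder} pvfield \<Rightarrow> (real ^ 'n::{finite, linorder}) set set" where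
  "invariant_parallels P =
     {{x. peval (parallel_poly k) x = 0} \<inter> sphere 0 1 | k.
        -1 < k \<and> k < 1 \<and> invariant_hyperplane P (parallel_poly k)}"

end

theory Submission
  imports Defs
begin

text \<open>
  Write \<open>y\<close> for the last variable and \<open>Q\<close> for the last component of the field. The derivative
  of \<open>y - k\<close> along the field is \<open>Q\<close> itself, so \<open>y = k\<close> is an invariant hyperplane exactly when
  \<open>y - k\<close> divides \<open>Q\<close>. If \<open>Q = 0\<close>, then every parallel is invariant; as the sphere has
  dimension at least one, the parallels are nonempty and pairwise distinct, which contradicts
  finiteness. If \<open>Q \<noteq> 0\<close>, collect the terms of \<open>Q\<close> by the monomial \<open>x\<^sup>\<beta>\<close> in the variables
  other than \<open>y\<close>: \<open>Q = (\<Sum>\<beta>. x\<^sup>\<beta> q\<^sub>\<beta>(y))\<close> with univariate \<open>q\<^sub>\<beta>\<close> of degree at most that of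
  \<open>Q\<close>. Some \<open>q\<^sub>\<beta>\<close> is nonzero, and since \<open>y - k\<close> does not involve the other variables it divides
  \<open>Q\<close> only if it divides each \<open>q\<^sub>\<beta>\<close> (lemma \<open>slice_mult_linear\<close>). Every invariant parallel is
  therefore given by a root of this \<open>q\<^sub>\<beta>\<close>, which has no more roots than its degree.
\<close>

section \<open>Univariate slices of a polynomial\<close>

lemma lookup_mult_single:
  fixes p :: "'a::cancel_comm_monoid_add \<Rightarrow>\<^sub>0 'b::comm_semiring_1"
  shows "Poly_Mapping.lookup (p * Poly_Mapping.single e c) b
    = Sum_any (\<lambda>a. Poly_Mapping.lookup p a * c when b = a + e)"
proof -
  have "(Poly_Mapping.lookup (Poly_Mapping.single e c) q when b = a + q)
      = ((c when b = a + e) when q = e)" for a q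
    by (auto simp: lookup_single when_def)
  then show ?thesis
    by (simp add: lookup_mult mult_when)
qed

lemma lookup_mult_single_add:
  fixes p :: "'a::cancel_comm_monoid_add \<Rightarrow>\<^sub>0 'b::comm_semiring_1"
  shows "Poly_Mapping.lookup (p * Poly_Mapping.single e c) (a + e) = Poly_Mapping.lookup p a * c"
  by (simp add: lookup_mult_single)

lemma lookup_mult_single_eq_0:
  fixes p :: "'a::cancel_comm_monoid_add \<Rightarrow>\<^sub>0 'b::comm_semiring_1"
  assumes "\<And>a. b \<noteq> a + e"
  shows "Poly_Mapping.lookup (p * Poly_Mapping.single e c) b = 0"
  using assms by (simp add: lookup_mult_single)

text \<open>
  The coefficient, a polynomial in \<open>x\<^sub>l\<close>, of the monomial \<open>\<beta>\<close> in the other variables. It has this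
  meaning when \<open>\<beta>\<close> does not involve \<open>x\<^sub>l\<close>.
\<close>

definition slice :: "'n \<Rightarrow> ('n \<Rightarrow>\<^sub>0 nat) \<Rightarrow> 'n rpoly \<Rightarrow> real poly" where
  "slice l \<beta> p = Abs_poly (\<lambda>j. Poly_Mapping.lookup p (\<beta> + Poly_Mapping.single l j))"

lemma inj_add_single: "inj (\<lambda>j. \<beta> + Poly_Mapping.single l (j::nat))"
proof (rule injI)
  fix i j
  assume "\<beta> + Poly_Mapping.single l i = \<beta> + Poly_Mapping.single l j"
  then have "Poly_Mapping.lookup (Poly_Mapping.single l i) l
      = Poly_Mapping.lookup (Poly_Mapping.single l j) l"
    by simp
  then show "i = j" by simp
qed

lemma coeff_slice:
  "coeff (slice l \<beta> p) j = Poly_Mapping.lookup p (\<beta> + Poly_Mapping.single l j)"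
proof -
  have "finite ((\<lambda>j. \<beta> + Poly_Mapping.single l j) -` Poly_Mapping.keys p)"
    by (rule finite_vimageI[OF finite_keys inj_add_single])
  then have "\<forall>\<^sub>\<infinity>j. Poly_Mapping.lookup p (\<beta> + Poly_Mapping.single l j) = 0"
    by (simp add: MOST_iff_cofinite vimage_def in_keys_iff)
  then show ?thesis
    unfolding slice_def by (simp add: Abs_poly_inverse)
qed

text \<open>
  Multiplication by \<open>x\<^sub>l\<close> shifts the coefficients within each slice and never mixes slices, so a
  factor in \<open>x\<^sub>l\<close> alone passes to every slice. If \<open>\<beta>\<close> involved \<open>x\<^sub>l\<close>, the shift would move the
  term below \<open>\<beta>\<close> into the constant coefficient.
\<close>

lemma slice_mult_linear:
  assumes "Poly_Mapping.lookup \<beta> l = 0"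
  shows "slice l \<beta> (p * (pvar l - pconst k)) = [:- k, 1:] * slice l \<beta> p"
proof (rule poly_eqI)
  fix j
  let ?b = "\<beta> + Poly_Mapping.single l j"
  have const: "Poly_Mapping.lookup (p * pconst k) ?b = k * Poly_Mapping.lookup p ?b"
    using lookup_mult_single_add[of p 0 k ?b] by (simp add: pconst_def)
  have var: "Poly_Mapping.lookup (p * pvar l) ?b
      = (case j of 0 \<Rightarrow> 0 | Suc i \<Rightarrow> Poly_Mapping.lookup p (\<beta> + Poly_Mapping.single l i))"
  proof (cases j)
    case 0
    have "?b \<noteq> a + Poly_Mapping.single l 1" for a
    proof
      assume "?b = a + Poly_Mapping.single l 1"
      then have "Poly_Mapping.lookup ?b l = Poly_Mapping.lookup (a + Poly_Mapping.single l 1) l"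
        by (rule arg_cong)
      then show False using assms 0 by (simp add: lookup_add)
    qed
    from lookup_mult_single_eq_0[OF this] show ?thesis
      using 0 by (simp add: pvar_def)
  next
    case (Suc i)
    then have "?b = (\<beta> + Poly_Mapping.single l i) + Poly_Mapping.single l 1"
      by (simp add: add.assoc flip: single_add)
    then show ?thesis
      using Suc lookup_mult_single_add[of p "Poly_Mapping.single l 1" 1 "\<beta> + Poly_Mapping.single l i"]
      by (simp add: pvar_def)
  qed
  show "coeff (slice l \<beta> (p * (pvar l - pconst k))) j = coeff ([:- k, 1:] * slice l \<beta> p) j"
    by (simp add: coeff_slice right_diff_distrib lookup_minus const var coeff_pCons split: nat.split)
qed

lemma degree_slice_le: "degree (slice l \<beta> p) \<le> pdegree p"
proof (rule degree_le, intro allI impI)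
  fix j
  assume j: "pdegree p < j"
  have "\<beta> + Poly_Mapping.single l j \<notin> Poly_Mapping.keys p"
  proof
    let ?b = "\<beta> + Poly_Mapping.single l j"
    assume "?b \<in> Poly_Mapping.keys p"
    then have "(\<Sum>i\<in>UNIV. Poly_Mapping.lookup ?b i) \<le> pdegree p"
      unfolding pdegree_def by (intro Max_ge) auto
    moreover have "Poly_Mapping.lookup ?b l \<le> (\<Sum>i\<in>UNIV. Poly_Mapping.lookup ?b i)"
      by (rule member_le_sum) auto
    ultimately show False using j by (simp add: lookup_add)
  qed
  then show "coeff (slice l \<beta> p) j = 0"
    by (simp add: coeff_slice in_keys_iff)
qed

lemma exists_nonzero_slice:
  assumes "p \<noteq> 0"
  obtains \<beta> where "Poly_Mapping.lookup \<beta> l = 0" and "slice l \<beta> p \<noteq> 0"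
proof -
  from assms obtain \<alpha> where \<alpha>: "Poly_Mapping.lookup p \<alpha> \<noteq> 0"
    by (metis lookup_zero poly_mapping_eqI)
  define \<beta> where "\<beta> = \<alpha> - Poly_Mapping.single l (Poly_Mapping.lookup \<alpha> l)"
  have "\<beta> + Poly_Mapping.single l (Poly_Mapping.lookup \<alpha> l) = \<alpha>"
    by (rule poly_mapping_eqI) (simp add: \<beta>_def lookup_add lookup_minus lookup_single when_def)
  then have "coeff (slice l \<beta> p) (Poly_Mapping.lookup \<alpha> l) \<noteq> 0"
    using \<alpha> by (simp add: coeff_slice)
  then have "slice l \<beta> p \<noteq> 0" by auto
  moreover have "Poly_Mapping.lookup \<beta> l = 0"
    by (simp add: \<beta>_def lookup_minus)
  ultimately show thesis by (rule that[rotated])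
qed

text \<open>
  One nonzero slice serves all the values \<open>k\<close> at once: each of them is a root of it.
\<close>

lemma card_linear_factors_le_pdegree:
  assumes "p \<noteq> 0"
  shows "finite {k. \<exists>q. p = q * (pvar l - pconst k)}"
    and "card {k. \<exists>q. p = q * (pvar l - pconst k)} \<le> pdegree p"
proof -
  obtain \<beta> where \<beta>: "Poly_Mapping.lookup \<beta> l = 0" and nz: "slice l \<beta> p \<noteq> 0"
    using assms by (rule exists_nonzero_slice)
  have sub: "{k. \<exists>q. p = q * (pvar l - pconst k)} \<subseteq> {k. poly (slice l \<beta> p) k = 0}"
    using slice_mult_linear[OF \<beta>] by auto
  have fin: "finite {k. poly (slice l \<beta> p) k = 0}"
    using nz by (rule poly_roots_finite)
  show "finite {k. \<exists>q. p = q * (pvar l - pconst k)}"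
    using sub fin by (rule finite_subset)
  have "card {k. \<exists>q. p = q * (pvar l - pconst k)} \<le> card {k. poly (slice l \<beta> p) k = 0}"
    using fin sub by (rule card_mono)
  also have "\<dots> \<le> degree (slice l \<beta> p)"
    using nz by (rule card_poly_roots_bound)
  also have "\<dots> \<le> pdegree p"
    by (rule degree_slice_le)
  finally show "card {k. \<exists>q. p = q * (pvar l - pconst k)} \<le> pdegree p" .
qed

section \<open>Horizontal hyperplanes and parallels\<close>

lemma lookup_linear:
  "Poly_Mapping.lookup (pvar l - pconst k) \<alpha>
    = (if \<alpha> = Poly_Mapping.single l 1 then 1 else if \<alpha> = 0 then - k else 0)"
  by (auto simp: pvar_def pconst_def lookup_minus lookup_single when_def
        dest: arg_cong[of _ _ "\<lambda>\<alpha>. Poly_Mapping.lookup \<alpha> l"])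

lemma keys_linear:
  "Poly_Mapping.keys (pvar l - pconst k) \<subseteq> {Poly_Mapping.single l 1, 0}"
  by (auto simp: in_keys_iff lookup_linear split: if_splits)

text \<open>
  The set of monomials of \<open>x\<^sub>l - k\<close> depends on whether \<open>k = 0\<close>; sums over it may be taken over
  both possible monomials.
\<close>

lemma sum_keys_linear:
  fixes g :: "('n \<Rightarrow>\<^sub>0 nat) \<Rightarrow> real \<Rightarrow> 'b::comm_monoid_add"
  assumes "\<And>\<alpha>. g \<alpha> 0 = 0"
  shows "(\<Sum>\<alpha>\<in>Poly_Mapping.keys (pvar l - pconst k). g \<alpha> (Poly_Mapping.lookup (pvar l - pconst k) \<alpha>))
    = g (Poly_Mapping.single l 1) 1 + g 0 (- k)"
proof -
  have ne: "Poly_Mapping.single l (1::nat) \<noteq> 0"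
    by (auto dest: arg_cong[of _ _ "\<lambda>\<alpha>. Poly_Mapping.lookup \<alpha> l"])
  have "(\<Sum>\<alpha>\<in>Poly_Mapping.keys (pvar l - pconst k). g \<alpha> (Poly_Mapping.lookup (pvar l - pconst k) \<alpha>))
      = (\<Sum>\<alpha>\<in>{Poly_Mapping.single l 1, 0}. g \<alpha> (Poly_Mapping.lookup (pvar l - pconst k) \<alpha>))"
    by (rule sum.mono_neutral_left[OF _ keys_linear]) (auto simp: in_keys_iff assms)
  also have "\<dots> = g (Poly_Mapping.single l 1) 1 + g 0 (- k)"
    using ne by (simp add: lookup_linear)
  finally show ?thesis .
qed

lemma peval_linear: "peval (pvar l - pconst k) x = x $ l - k"
proof -
  have "(\<Prod>i\<in>UNIV. (x $ i) ^ Poly_Mapping.lookup (Poly_Mapping.single l 1) i)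
      = (\<Prod>i\<in>UNIV. if i = l then x $ i else 1)"
    by (rule prod.cong) (auto simp: lookup_single when_def)
  then show ?thesis
    unfolding peval_def
    by (subst sum_keys_linear[of "\<lambda>\<alpha> c. c * (\<Prod>i\<in>UNIV. (x $ i) ^ Poly_Mapping.lookup \<alpha> i)"]) simp_all
qed

lemma pdiff_linear: "pdiff i (pvar l - pconst k) = (if i = l then 1 else 0)"
  unfolding pdiff_def
  by (subst sum_keys_linear[of "\<lambda>\<alpha> c. Poly_Mapping.single (\<alpha> - Poly_Mapping.single i 1)
        (c * real (Poly_Mapping.lookup \<alpha> i))"])
     (simp_all add: lookup_single when_def flip: single_one)

lemma pdegree_linear: "pdegree (pvar l - pconst k) = 1"
proof -
  have total: "(\<Sum>i\<in>UNIV. Poly_Mapping.lookup (Poly_Mapping.single l (1::nat)) i) = 1"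
    by (simp add: lookup_single when_def)
  have "Poly_Mapping.single l 1 \<in> Poly_Mapping.keys (pvar l - pconst k)"
    by (simp add: in_keys_iff lookup_linear)
  from imageI[OF this, of "\<lambda>\<alpha>. \<Sum>i\<in>UNIV. Poly_Mapping.lookup \<alpha> i"]
  have "1 \<in> (\<lambda>\<alpha>. \<Sum>i\<in>UNIV. Poly_Mapping.lookup \<alpha> i) ` Poly_Mapping.keys (pvar l - pconst k)"
    by (simp only: total)
  then show ?thesis
    unfolding pdegree_def using keys_linear[of l k] total
    by (intro Max_eqI) auto
qed

lemma invariant_hyperplane_linear_iff:
  "invariant_hyperplane P (pvar l - pconst k) \<longleftrightarrow> (\<exists>q. P l = q * (pvar l - pconst k))"
proof -
  have "vf_apply P (pvar l - pconst k) = P l"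
    by (simp add: vf_apply_def pdiff_linear if_distrib cong: if_cong)
  then show ?thesis
    by (simp add: invariant_hyperplane_def pdegree_linear)
qed

lemma exists_on_sphere_with_coordinate:
  fixes l :: "'n::finite"
  assumes "CARD('n) \<ge> 2" and "-1 \<le> k" and "k \<le> 1"
  obtains x :: "real ^ 'n" where "x \<in> sphere 0 1" and "x $ l = k"
proof -
  from assms(1) have "UNIV \<noteq> {l}" by (auto dest: arg_cong[of _ _ card])
  then obtain j where j: "j \<noteq> l" by auto
  define x :: "real ^ 'n" where "x = k *\<^sub>R axis l 1 + sqrt (1 - k\<^sup>2) *\<^sub>R axis j 1"
  have "k\<^sup>2 \<le> 1"
    using assms(2,3) by (simp add: abs_square_le_1 abs_le_iff)
  then have "x \<bullet> x = 1"
    using j by (simp add: x_def inner_add_left inner_add_right inner_axis_axis power2_eq_square[symmetric])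
  then have "x \<in> sphere 0 1" by (simp add: norm_eq_1)
  moreover have "x $ l = k" using j by (simp add: x_def axis_def)
  ultimately show thesis by (rule that)
qed

text \<open>
  Parallels are compared as sets of points, so distinct heights give distinct parallels only because
  these are nonempty. On the zero-dimensional sphere, which consists of the two poles, every
  parallel is empty.
\<close>

lemma inj_on_parallel:
  assumes "CARD('n::finite) \<ge> 2"
  shows "inj_on (\<lambda>k. {x :: real ^ 'n. peval (pvar l - pconst k) x = 0} \<inter> sphere 0 1) {-1<..<1}"
proof (rule inj_onI)
  fix k k' :: real
  assume k: "k \<in> {-1<..<1}"
    and eq: "{x :: real ^ 'n. peval (pvar l - pconst k) x = 0} \<inter> sphere 0 1
      = {x. peval (pvar l - pconst k') x = 0} \<inter> sphere 0 1"
  obtain x :: "real ^ 'n" where "x \<in> sphere 0 1" "x $ l = k"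
    using exists_on_sphere_with_coordinate[OF assms, of k l] k by auto
  then have "x \<in> {x. peval (pvar l - pconst k) x = 0} \<inter> sphere 0 1"
    by (simp add: peval_linear)
  then have "x \<in> {x. peval (pvar l - pconst k') x = 0} \<inter> sphere 0 1"
    unfolding eq .
  then show "k = k'" using \<open>x $ l = k\<close> by (simp add: peval_linear)
qed

theorem theorem7:
  fixes P :: "'n::{finite, linorder} pvfield"
    and m :: "'n \<Rightarrow> nat"
    and n :: nat
  assumes "n \<ge> 1"
    and "CARD('n) = n + 1"
    and "vf_on_sphere P"
    and "has_vf_degree P m"
    and "\<forall>i j. i \<le> j \<longrightarrow> m j \<le> m i"
    and "finite (invariant_parallels P)"
  shows "card (invariant_parallels P) \<le> m last_index"
proof -
  let ?l = "last_index :: 'n"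
  define par where "par k = {x :: real ^ 'n::{finite, linorder}. peval (pvar ?l - pconst k) x = 0} \<inter> sphere 0 1" for k
  define F where "F = {k. \<exists>q. P ?l = q * (pvar ?l - pconst k)}"
  have parallels: "invariant_parallels P = par ` ({-1<..<1} \<inter> F)"
    unfolding invariant_parallels_def parallel_poly_def invariant_hyperplane_linear_iff par_def F_def
    by auto
  have "P ?l \<noteq> 0"
  proof
    assume "P ?l = 0"
    then have "F = UNIV" unfolding F_def by (auto intro: exI[of _ 0])
    moreover have "inj_on par {-1<..<1}"
      unfolding par_def using assms(1,2) by (intro inj_on_parallel) simp
    ultimately have "finite {-1<..<1::real}"
      using assms(6) unfolding parallels by (simp add: finite_image_iff)
    then show False by (simp add: infinite_Ioo)
  qed
  then have F: "finite F" "card F \<le> pdegree (P ?l)"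
    unfolding F_def by (rule card_linear_factors_le_pdegree)+
  have "card (invariant_parallels P) \<le> card ({-1<..<1} \<inter> F)"
    unfolding parallels using F(1) by (intro card_image_le) simp
  also have "\<dots> \<le> card F"
    using F(1) by (intro card_mono) auto
  also have "\<dots> \<le> m ?l"
    using F(2) assms(4) by (simp add: has_vf_degree_def)
  finally show ?thesis .
qed

end
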